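(* Let $X$ be a complex Banach space and $T\in\mathcal{B}(X)$. Then the following statements are equivalent: (i) There exists $S_1\in\mathcal{B}(X)$ such that $TS_1T=S_1T^2$, $S_1^2T=S_1$, and $TS_1T-T$ is quasi-nilpotent. (ii) There exists a projection $P\in\mathcal{B}(X)$ such that $TP=PT$, $T+P$ is left invertible and $TP$ is quasi-nilpotent. (iii) $H_0(T)$ is topologically complemented in $X$ with a closed subspace $M$ (that is, $X=M\oplus H_0(T)$ with both summands closed) such that $\mathcal{R}(T|_M)$ is contained in $M$ and is topologically complemented in $M$. (iv) There exists a closed subspace $M$ such that $X=M\oplus H_0(T)$, $T|_M$ is left invertible and $T|_{H_0(T)}$ is quasi-nilpotent, where $M$ and $H_0(T)$ reduce $T$. (v) There exist two closed subspaces $M$ and $N$ reducing $T$ such that $T|_M$ is left invertible and $T|_N$ is quasi-nilpotent.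
   Context: $\mathcal{B}(X)$ is the algebra of bounded linear operators on $X$; $\mathcal{R}(T)$ is the range of $T$. An operator $A$ on a Banach space is quasi-nilpotent if $\lim_{n\to\infty}\|A^n\|^{1/n}=0$. A projection is an idempotent in $\mathcal{B}(X)$. An operator $A\in\mathcal{B}(Y)$ is left invertible if there is $B\in\mathcal{B}(Y)$ with $BA=I$. The quasi-nilpotent part of $T$ is $H_0(T)=\{x\in X:\lim_{n\to\infty}\|T^nx\|^{1/n}=0\}$. Closed subspaces $M,N$ of $X$ reduce $T$ if $X=M\oplus N$ and both $M$ and $N$ are invariant under $T$; then $T|_M\in\mathcal{B}(M)$ and $T|_N\in\mathcal{B}(N)$ are the restrictions. A closed subspace is topologically complemented if it has a closed complement. *)

theory Defs
  imports "HOL-Analysis.Analysis"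
begin

text \<open>
  The distribution only has type classes for real normed spaces; a complex normed space is a real
  one together with a compatible complex scalar multiplication.
\<close>

class complex_vector = real_vector +
  fixes scaleC :: "complex \<Rightarrow> 'a \<Rightarrow> 'a"  (infixr \<open>*\<^sub>C\<close> 75)
  assumes scaleC_add_right: "a *\<^sub>C (x + y) = a *\<^sub>C x + a *\<^sub>C y"
    and scaleC_add_left: "(a + b) *\<^sub>C x = a *\<^sub>C x + b *\<^sub>C x"
    and scaleC_scaleC: "a *\<^sub>C b *\<^sub>C x = (a * b) *\<^sub>C x"
    and scaleC_one: "1 *\<^sub>C x = x"
    and scaleR_scaleC: "r *\<^sub>R x = complex_of_real r *\<^sub>C x"

class complex_normed_vector = complex_vector + real_normed_vector +
  assumes norm_scaleC: "norm (a *\<^sub>C x) = cmod a * norm x"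

class complex_banach = complex_normed_vector + banach

instantiation complex :: complex_banach
begin
definition scaleC_complex :: "complex \<Rightarrow> complex \<Rightarrow> complex"
  where "scaleC_complex a x = a * x"
instance
  by standard (auto simp: scaleC_complex_def algebra_simps norm_mult scaleR_conv_of_real)
end

global_interpretation complex_vector:
  vector_space "scaleC :: complex \<Rightarrow> 'a \<Rightarrow> 'a::complex_vector"
  by standard (auto simp: scaleC_add_right scaleC_add_left scaleC_scaleC scaleC_one)

definition closed_subspace :: "'a::complex_normed_vector set \<Rightarrow> bool"
  where "closed_subspace M \<longleftrightarrow> complex_vector.subspace M \<and> closed M"


text \<open>
  Operators on a closed subspace \<open>Y\<close> are represented by functions on the whole type of which
  only the values on \<open>Y\<close> matter. Thus \<open>T\<close> itself represents the restriction of \<open>T\<close> to \<open>Y\<close>,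
  and \<open>Y = UNIV\<close> gives the operators on the whole space.
\<close>

definition bounded_operators :: "'a::complex_normed_vector set \<Rightarrow> ('a \<Rightarrow> 'a) set"  (\<open>\<B>\<close>)
  where "\<B> Y = {A. A ` Y \<subseteq> Y \<and>
    (\<forall>x\<in>Y. \<forall>y\<in>Y. A (x + y) = A x + A y) \<and>
    (\<forall>c. \<forall>x\<in>Y. A (c *\<^sub>C x) = c *\<^sub>C A x) \<and>
    (\<exists>K. \<forall>x\<in>Y. norm (A x) \<le> K * norm x)}"

definition onorm_on :: "'a::complex_normed_vector set \<Rightarrow> ('a \<Rightarrow> 'a) \<Rightarrow> real"
  where "onorm_on Y A = (SUP x\<in>Y. norm (A x) / norm x)"

lemma bounded_operators_UNIV:
  "A \<in> \<B> UNIV \<longleftrightarrow> bounded_linear A \<and> (\<forall>c x. A (c *\<^sub>C x) = c *\<^sub>C A x)"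
  unfolding bounded_operators_def
  by (auto simp: bounded_linear_def bounded_linear_axioms_def linear_iff scaleR_scaleC mult.commute)

lemma onorm_on_UNIV: "onorm_on UNIV A = onorm A"
  by (simp add: onorm_on_def onorm_def)

definition quasi_nilpotent_on :: "'a::complex_normed_vector set \<Rightarrow> ('a \<Rightarrow> 'a) \<Rightarrow> bool"
  where "quasi_nilpotent_on Y A \<longleftrightarrow>
    A \<in> \<B> Y \<and> (\<lambda>n. root n (onorm_on Y (A ^^ n))) \<longlonglongrightarrow> 0"

definition left_invertible_on :: "'a::complex_normed_vector set \<Rightarrow> ('a \<Rightarrow> 'a) \<Rightarrow> bool"
  where "left_invertible_on Y A \<longleftrightarrow> A \<in> \<B> Y \<and> (\<exists>B\<in>\<B> Y. \<forall>x\<in>Y. B (A x) = x)"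

definition projection :: "('a::complex_normed_vector \<Rightarrow> 'a) \<Rightarrow> bool"
  where "projection P \<longleftrightarrow> P \<in> \<B> UNIV \<and> P \<circ> P = P"

definition quasi_nilpotent_part :: "('a::complex_normed_vector \<Rightarrow> 'a) \<Rightarrow> 'a set"  (\<open>H\<^sub>0\<close>)
  where "H\<^sub>0 T = {x. (\<lambda>n. root n (norm ((T ^^ n) x))) \<longlonglongrightarrow> 0}"

text \<open>
  \<open>Y\<close> is the direct sum of its closed subspaces \<open>M\<close> and \<open>N\<close>. When \<open>Y\<close> is itself closed,
  closedness in \<open>Y\<close> is closedness in the whole space.
\<close>

definition topological_direct_sum ::
    "'a::complex_normed_vector set \<Rightarrow> 'a set \<Rightarrow> 'a set \<Rightarrow> bool"
  where "topological_direct_sum Y M N \<longleftrightarrow>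
    closed_subspace M \<and> closed_subspace N \<and>
    Y = {m + n | m n. m \<in> M \<and> n \<in> N} \<and> M \<inter> N = {0}"

definition topologically_complemented_in ::
    "'a::complex_normed_vector set \<Rightarrow> 'a set \<Rightarrow> bool"
  where "topologically_complemented_in Y M \<longleftrightarrow> (\<exists>N. topological_direct_sum Y M N)"

definition reduce ::
    "'a::complex_normed_vector set \<Rightarrow> 'a set \<Rightarrow> ('a \<Rightarrow> 'a) \<Rightarrow> bool"
  where "reduce M N T \<longleftrightarrow>
    topological_direct_sum UNIV M N \<and> T ` M \<subseteq> M \<and> T ` N \<subseteq> N"

end

theory Submission
  imports Defs
begin

text \<open>
  All statements are equivalent to the existence of a bounded projection \<open>P\<close> and an operator \<open>S\<close>
  such that \<open>T P = P T\<close>, \<open>S T = I - P\<close>, \<open>S P = 0\<close> and \<open>T P\<close> is quasi-nilpotent: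
  in (i) take \<open>P = I - S\<^sub>1 T\<close>, and in (ii) a left inverse of \<open>T + P\<close> is \<open>S + R P\<close>, where the Neumann
  series \<open>R\<close> inverts \<open>I + T P\<close>. For a decomposition as in (v), \<open>\<parallel>m\<parallel> \<le> K\<^sup>n \<parallel>T\<^sup>n m\<parallel>\<close> on \<open>M\<close> forces
  \<open>N = H\<^sub>0 T\<close>. Conversely, when \<open>H\<^sub>0 T\<close> is closed, the uniform boundedness principle for the
  operators \<open>T\<^sup>n / \<epsilon>\<^sup>n\<close> makes \<open>T\<close> quasi-nilpotent on it, and \<open>T\<close> is injective on the complement \<open>M\<close>,
  so that the inverse mapping theorem turns a complement of \<open>T(M)\<close> in \<open>M\<close> into a left inverse.
  Boundedness of the projections, of the left inverse and the uniform boundedness principle all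
  come from Zabreiko's lemma.
\<close>

subsection \<open>Automatic continuity via the Baire category theorem\<close>

text \<open>
  Zabreiko's lemma. By Baire, some sublevel set of \<open>p\<close> is dense in a ball around 0; successive
  approximation with halving errors then bounds \<open>p\<close> on that ball.
\<close>
lemma countably_subadditive_seminorm_bounded:
  fixes p :: "'a::banach \<Rightarrow> real"
  assumes Y: "subspace Y" "closed Y"
    and scale: "\<And>c x. x \<in> Y \<Longrightarrow> p (c *\<^sub>R x) = \<bar>c\<bar> * p x"
    and subadd: "\<And>f x. \<lbrakk>\<And>n. f n \<in> Y; f sums x; summable (\<lambda>n. p (f n))\<rbrakk> \<Longrightarrow> p x \<le> (\<Sum>n. p (f n))"
  shows "\<exists>K. \<forall>x\<in>Y. p x \<le> K * norm x"
proof -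
  have p0: "p 0 = 0"
    using scale[of 0 0] Y by (simp add: subspace_0)
  have add: "p (x + y) \<le> p x + p y" if "x \<in> Y" "y \<in> Y" for x y
  proof -
    \<comment> \<open>A sum of two terms is the series \<open>x\<close>, \<open>y\<close>, 0, 0,
      ..., whose tail costs nothing because \<open>p 0 = 0\<close>.\<close>
    define f where "f = (\<lambda>n::nat. if n = 0 then x else if n = 1 then y else 0)"
    have "f sums (\<Sum>n\<in>{0,1}. f n)" "(\<lambda>n. p (f n)) sums (\<Sum>n\<in>{0,1}. p (f n))"
      by (rule sums_finite; simp add: f_def p0)+
    then have "f sums (x + y)" "(\<lambda>n. p (f n)) sums (p x + p y)"
      by (simp_all add: f_def)
    moreover have "f n \<in> Y" for n
      using that Y by (simp add: f_def subspace_0)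
    ultimately show ?thesis
      using subadd[of f "x + y"] by (simp add: sums_iff)
  qed
  have nonneg: "p x \<ge> 0" if "x \<in> Y" for x
    using add[of x "- x"] scale[of x "- 1"] that Y p0 by (simp add: subspace_neg)
  have diff: "p (x - y) \<le> p x + p y" if "x \<in> Y" "y \<in> Y" for x y
    using add[of x "- y"] scale[of y "- 1"] that Y by (simp add: subspace_neg)
  define S where "S = (\<lambda>n. {y \<in> Y. p y \<le> real n})"
  \<comment> \<open>The values of \<open>p\<close> are finite, so the sets \<open>S n\<close> cover
    \<open>Y\<close>. By Baire in the complete space \<open>Y\<close>, the closure of one of them
    has nonempty interior relative to \<open>Y\<close>.\<close>
  have "\<exists>n. top_of_set Y interior_of closure (S n) \<noteq> {}"
  proof (rule ccontr)
    assume "\<not> ?thesis"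
    moreover have SY: "closure (S n) \<subseteq> Y" for n
      using Y by (intro closure_minimal) (auto simp: S_def)
    ultimately have "top_of_set Y interior_of \<Union>(range (\<lambda>n. closure (S n))) = {}"
      using Y
      by (intro Baire_category_alt disjI1 completely_metrizable_space_closedin
          completely_metrizable_space_euclidean) (auto simp: closed_closedin[symmetric] closed_subset)
    moreover have "\<Union>(range (\<lambda>n. closure (S n))) = Y"
    proof
      show "Y \<subseteq> \<Union>(range (\<lambda>n. closure (S n)))"
      proof
        fix y assume "y \<in> Y"
        moreover obtain n where "p y \<le> real n"
          using real_arch_simple by blast
        ultimately have "y \<in> S n"
          by (simp add: S_def)
        then show "y \<in> \<Union>(range (\<lambda>n. closure (S n)))"
          using closure_subset by blast
      qed
    qed (use SY in blast)
    ultimately have "top_of_set Y interior_of Y = {}"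
      by simp
    then show False
      using Y subspace_0 interior_of_topspace[of "top_of_set Y"] by auto
  qed
  then obtain n a where a: "a \<in> top_of_set Y interior_of closure (S n)"
    by blast
  define U where "U = top_of_set Y interior_of closure (S n)"
  have U: "a \<in> U" "U \<subseteq> closure (S n)" "openin (top_of_set Y) U"
    using a by (simp_all add: U_def interior_of_subset)
  then obtain r where r: "r > 0" "\<And>y. y \<in> Y \<Longrightarrow> dist y a < r \<Longrightarrow> y \<in> closure (S n)" and "a \<in> Y"
    unfolding openin_euclidean_subtopology_iff by fast
  \<comment> \<open>The ball moves from \<open>a\<close> to 0: \<open>y\<close> is half of
    \<open>(a + y) - (a - y)\<close>, both of which are limits of \<open>S n\<close>, and half the
    difference of two elements of \<open>S n\<close> has \<open>p\<close>-value at most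
    \<open>n\<close>.\<close>
  have approx: "\<exists>z\<in>Y. p z \<le> n \<and> norm (y - z) < e" if y: "y \<in> Y" "norm y < r" "e > 0" for y e
  proof -
    have "a + y \<in> closure (S n)" "a - y \<in> closure (S n)"
      using r \<open>a \<in> Y\<close> y Y by (auto simp: dist_norm subspace_add subspace_diff)
    then obtain u v where uv: "u \<in> S n" "dist u (a + y) < e" "v \<in> S n" "dist v (a - y) < e"
      using \<open>e > 0\<close> by (meson closure_approachable)
    define z where "z = (1/2) *\<^sub>R (u - v)"
    have "y - z = (1/2) *\<^sub>R ((v - (a - y)) - (u - (a + y)))"
      by (simp add: z_def algebra_simps flip: scaleR_add_left)
    then have "norm (y - z) = (1/2) * norm ((v - (a - y)) - (u - (a + y)))"
      by simp
    also have "\<dots> < e"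
      using uv norm_triangle_ineq4[of "v - (a - y)" "u - (a + y)"] by (simp add: dist_norm)
    finally have "norm (y - z) < e" .
    moreover have "z \<in> Y"
      using uv Y by (simp add: z_def S_def subspace_scale subspace_diff)
    moreover have "p z \<le> n"
      using scale[of "u - v" "1/2"] diff[of u v] uv Y by (simp add: z_def S_def subspace_diff)
    ultimately show ?thesis by blast
  qed
  \<comment> \<open>Homogeneity carries the approximation to every scale: treat
    \<open>2^k *\<^sub>R y\<close> with error \<open>r / 2\<close> and shrink back.\<close>
  have approx': "\<exists>z\<in>Y. p z \<le> n * (1/2)^k \<and> norm (y - z) < r * (1/2)^Suc k"
    if y: "y \<in> Y" "norm y < r * (1/2)^k" for y k
  proof -
    have "norm (2^k *\<^sub>R y) < r"
      using y by (simp add: field_simps)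
    then obtain z where z: "z \<in> Y" "p z \<le> n" "norm (2^k *\<^sub>R y - z) < r / 2"
      using approx[of "2^k *\<^sub>R y" "r / 2"] r y Y by (auto simp: subspace_scale)
    define w where "w = (1/2)^k *\<^sub>R z"
    have "y - w = (1/2)^k *\<^sub>R (2^k *\<^sub>R y - z)"
      by (simp add: w_def algebra_simps power_one_over)
    then have "norm (y - w) = (1/2)^k * norm (2^k *\<^sub>R y - z)"
      by simp
    also have "\<dots> < (1/2)^k * (r / 2)"
      using z by (intro mult_strict_left_mono) auto
    finally have "norm (y - w) < r * (1/2)^Suc k"
      by (simp add: mult.commute)
    moreover have "p w \<le> n * (1/2)^k"
      using z by (simp add: w_def scale mult.commute)
    moreover have "w \<in> Y"
      using z Y by (simp add: w_def subspace_scale)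
    ultimately show ?thesis by blast
  qed
  have bound: "p y \<le> 2 * n" if y: "y \<in> Y" "norm y < r" for y
  proof -
    \<comment> \<open>\<open>R k\<close> is the error left after \<open>k\<close> corrections. The
      errors tend to 0, so the corrections telescope to \<open>y\<close>, while their
      \<open>p\<close>-values are dominated by a geometric series with sum
      \<open>2 * n\<close>.\<close>
    have "\<exists>R. \<forall>k. ((R k \<in> Y \<and> norm (R k) < r * (1/2)^k) \<and> (k = 0 \<longrightarrow> R k = y)) \<and>
        p (R k - R (Suc k)) \<le> n * (1/2)^k"
    proof (rule dependent_nat_choice)
      show "\<exists>x. (x \<in> Y \<and> norm x < r * (1/2)^0) \<and> (0 = (0::nat) \<longrightarrow> x = y)"
        using y by auto
      show "\<exists>x'. ((x' \<in> Y \<and> norm x' < r * (1/2)^Suc k) \<and> (Suc k = 0 \<longrightarrow> x' = y)) \<and>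
          p (x - x') \<le> n * (1/2)^k"
        if x: "(x \<in> Y \<and> norm x < r * (1/2)^k) \<and> (k = 0 \<longrightarrow> x = y)" for x k
      proof -
        obtain z where "z \<in> Y" "p z \<le> n * (1/2)^k" "norm (x - z) < r * (1/2)^Suc k"
          using approx' x by blast
        then show ?thesis
          using x Y by (intro exI[of _ "x - z"]) (auto simp: subspace_diff)
      qed
    qed
    then obtain R where R: "\<And>k. R k \<in> Y" "\<And>k. norm (R k) < r * (1/2)^k" "R 0 = y"
        "\<And>k. p (R k - R (Suc k)) \<le> n * (1/2)^k"
      by blast
    have "(\<lambda>k. r * (1/2)^k) \<longlonglongrightarrow> r * 0"
      by (intro tendsto_mult tendsto_const LIMSEQ_power_zero) auto
    then have "R \<longlonglongrightarrow> 0"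
      by (intro Lim_null_comparison[of R "\<lambda>k. r * (1/2)^k"])
        (auto intro!: always_eventually less_imp_le R)
    then have "(\<lambda>k. R k - R (Suc k)) sums (R 0 - 0)"
      by (rule telescope_sums')
    moreover have geo: "(\<lambda>k. n * (1/2)^k) sums (n * (1 / (1 - 1/2)))"
      by (intro sums_mult geometric_sums) auto
    moreover have RY: "R k - R (Suc k) \<in> Y" for k
      using R Y by (simp add: subspace_diff)
    moreover have sm: "summable (\<lambda>k. p (R k - R (Suc k)))"
      by (rule summable_comparison_test'[OF sums_summable[OF geo], where N=0])
        (use R RY nonneg in auto)
    ultimately have "p y \<le> (\<Sum>k. p (R k - R (Suc k)))"
      using subadd[of "\<lambda>k. R k - R (Suc k)" y] R by simp
    also have "\<dots> \<le> (\<Sum>k. n * (1/2)^k)"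
      using R by (intro suminf_le sm sums_summable[OF geo])
    also have "\<dots> = 2 * n"
      using geo by (simp add: sums_iff)
    finally show ?thesis by simp
  qed
  \<comment> \<open>Rescaling \<open>x\<close> to norm \<open>r / 2\<close> puts it inside the ball,
    which explains the factor \<open>4 * n / r\<close>.\<close>
  have "p x \<le> (4 * n / r) * norm x" if x: "x \<in> Y" for x
  proof (cases "x = 0")
    case False
    have "p ((r / (2 * norm x)) *\<^sub>R x) \<le> 2 * n"
      using x Y False r by (intro bound) (auto simp: subspace_scale)
    then show ?thesis
      using False r x by (simp add: scale field_simps)
  qed (simp add: p0)
  then show ?thesis by blast
qed

text \<open>The pointwise supremum of the norms is finite on \<open>Y\<close> and inherits countable
  subadditivity from each \<open>A i\<close>, so Zabreiko's lemma bounds it by a multiple of the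
  norm.\<close>

lemma pointwise_bounded_imp_uniformly_bounded:
  fixes A :: "'i \<Rightarrow> 'a::banach \<Rightarrow> 'b::banach"
  assumes Y: "subspace Y" "closed Y"
    and A: "\<And>i. bounded_linear (A i)"
    and bdd: "\<And>x. x \<in> Y \<Longrightarrow> \<exists>C. \<forall>i. norm (A i x) \<le> C"
  shows "\<exists>C. \<forall>i. \<forall>x\<in>Y. norm (A i x) \<le> C * norm x"
proof -
  define p where "p x = (SUP i. norm (A i x))" for x
  have bddY: "bdd_above (range (\<lambda>i. norm (A i x)))" if "x \<in> Y" for x
    using bdd[OF that] by (auto intro: bdd_aboveI2)
  have le: "norm (A i x) \<le> p x" if "x \<in> Y" for i x
    unfolding p_def by (rule cSUP_upper[OF UNIV_I bddY[OF that]])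
  have "\<exists>K. \<forall>x\<in>Y. p x \<le> K * norm x"
  proof (rule countably_subadditive_seminorm_bounded[OF Y])
    fix c :: real and x assume x: "x \<in> Y"
    have "p (c *\<^sub>R x) = (SUP i. \<bar>c\<bar> * norm (A i x))"
      by (simp add: p_def linear_simps(5)[OF A])
    also have "\<dots> = \<bar>c\<bar> * p x"
      unfolding p_def using bddY[OF x]
      by (subst continuous_at_Sup_mono[of "\<lambda>t. \<bar>c\<bar> * t"])
        (auto simp: mono_def mult_left_mono image_image intro!: continuous_intros)
    finally show "p (c *\<^sub>R x) = \<bar>c\<bar> * p x" .
  next
    fix f x assume f: "\<And>n. f n \<in> Y" "f sums x" "summable (\<lambda>n. p (f n))"
    show "p x \<le> (\<Sum>n. p (f n))"
      unfolding p_def[of x]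
    proof (rule cSUP_least)
      fix i
      have s: "(\<lambda>n. A i (f n)) sums A i x"
        using bounded_linear.sums[OF A f(2)] .
      have n: "summable (\<lambda>n. norm (A i (f n)))"
        by (rule summable_comparison_test'[OF f(3), where N=0]) (use f le in auto)
      have "norm (A i x) = norm (\<Sum>n. A i (f n))"
        using s by (simp add: sums_iff)
      also have "\<dots> \<le> (\<Sum>n. norm (A i (f n)))"
        by (rule summable_norm[OF n])
      also have "\<dots> \<le> (\<Sum>n. p (f n))"
        using f le n by (intro suminf_le) auto
      finally show "norm (A i x) \<le> (\<Sum>n. p (f n))" .
    qed simp
  qed
  then show ?thesis
    using le order_trans by blast
qed

text \<open>The component map \<open>A m + w \<mapsto> m\<close> is well defined by injectivity, and
  its norm is countably subadditive: absolutely summable components converge in \<open>M\<close>,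
  and closedness of \<open>W\<close> identifies their sum as the component of the limit. The
  identity for \<open>A\<close> yields projections, \<open>T\<close> yields left inverses.\<close>

lemma direct_sum_component_bounded:
  fixes A :: "'a::banach \<Rightarrow> 'b::banach"
  assumes A: "bounded_linear A"
    and M: "subspace M" "closed M" and W: "subspace W" "closed W" and Y: "subspace Y" "closed Y"
    and Y_eq: "Y = {A m + w | m w. m \<in> M \<and> w \<in> W}"
    and inj: "\<And>m w. \<lbrakk>m \<in> M; w \<in> W; A m + w = 0\<rbrakk> \<Longrightarrow> m = 0"
  shows "\<exists>K. \<forall>m\<in>M. \<forall>w\<in>W. norm m \<le> K * norm (A m + w)"
proof -
  interpret A: bounded_linear A by fact
  define g where "g = (\<lambda>y. THE m. m \<in> M \<and> y - A m \<in> W)"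
  have g_eq: "g y = m" if "m \<in> M" "y - A m \<in> W" for y m
    unfolding g_def
  proof (rule the_equality)
    fix m' assume "m' \<in> M \<and> y - A m' \<in> W"
    then have "m' - m \<in> M" "(y - A m) - (y - A m') \<in> W"
      using that M W by (simp_all only: subspace_diff)
    moreover have "(y - A m) - (y - A m') = A (m' - m)"
      by (simp add: A.diff)
    ultimately have "m' - m = 0"
      using inj[of "m' - m" "- A (m' - m)"] W by (simp add: subspace_neg)
    then show "m' = m" by simp
  qed (use that in simp)
  have g: "g y \<in> M" "y - A (g y) \<in> W" if y: "y \<in> Y" for y
  proof -
    obtain m w where "m \<in> M" "w \<in> W" "y = A m + w"
      using y Y_eq by blast
    then show "g y \<in> M" "y - A (g y) \<in> W"
      using g_eq[of m y] by simp_all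
  qed
  have "\<exists>K. \<forall>y\<in>Y. norm (g y) \<le> K * norm y"
  proof (rule countably_subadditive_seminorm_bounded[OF Y])
    fix c :: real and y assume "y \<in> Y"
    then have "g (c *\<^sub>R y) = c *\<^sub>R g y"
      using g[of y] M W by (intro g_eq) (simp_all add: A.scaleR subspace_scale flip: scaleR_diff_right)
    then show "norm (g (c *\<^sub>R y)) = \<bar>c\<bar> * norm (g y)"
      by simp
  next
    fix f y assume f: "\<And>n. f n \<in> Y" "f sums y" "summable (\<lambda>n. norm (g (f n)))"
    have s: "(\<lambda>n. g (f n)) sums (\<Sum>n. g (f n))"
      using summable_norm_cancel[OF f(3)] by (rule summable_sums)
    \<comment> \<open>Stated for an arbitrary type, since it serves both \<open>M\<close> in the
      domain of \<open>A\<close> and \<open>W\<close> in its codomain.\<close>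
    have closed_sums: "x \<in> V" if "subspace V" "closed V" "h sums x" "\<And>n. h n \<in> V"
      for h :: "nat \<Rightarrow> 'c::real_normed_vector" and V x
      using that unfolding sums_def
      by (elim closed_sequentially) (auto intro: subspace_sum)
    have "(\<Sum>n. g (f n)) \<in> M"
      using closed_sums[OF M s] g f by blast
    moreover have "y - A (\<Sum>n. g (f n)) \<in> W"
      using closed_sums[OF W sums_diff[OF f(2) A.sums[OF s]]] g f by blast
    ultimately have "g y = (\<Sum>n. g (f n))"
      by (rule g_eq)
    then show "norm (g y) \<le> (\<Sum>n. norm (g (f n)))"
      using summable_norm[OF f(3)] by simp
  qed
  then obtain K where K: "\<And>y. y \<in> Y \<Longrightarrow> norm (g y) \<le> K * norm y"
    by blast
  have "norm m \<le> K * norm (A m + w)" if "m \<in> M" "w \<in> W" for m w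
    using K[of "A m + w"] g_eq[of m "A m + w"] that Y_eq by auto
  then show ?thesis by blast
qed

subsection \<open>Quasi-nilpotent operators\<close>

text \<open>Geometric bounds with arbitrary ratio replace the roots; they add and scale easily.
  Forwards, finitely many exceptional terms are absorbed into \<open>C\<close>; backwards, the roots
  of a positive constant tend to 1.\<close>

lemma root_tendsto_0_iff:
  fixes a :: "nat \<Rightarrow> real"
  assumes a: "\<And>n. a n \<ge> 0"
  shows "(\<lambda>n. root n (a n)) \<longlonglongrightarrow> 0 \<longleftrightarrow> (\<forall>e>0. \<exists>C. \<forall>n. a n \<le> C * e ^ n)"
proof (intro iffI allI impI)
  fix e :: real assume lim: "(\<lambda>n. root n (a n)) \<longlonglongrightarrow> 0" and e: "e > 0"
  obtain N where N: "\<And>n. n \<ge> N \<Longrightarrow> root n (a n) < e"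
    using order_tendstoD(2)[OF lim e] by (auto simp: eventually_sequentially)
  \<comment> \<open>The sum covers the initial terms and the summand 1 covers the tail. The cut is
    at \<open>Suc N\<close> so that tail indices are positive and the root undoes the power.\<close>
  define C where "C = 1 + (\<Sum>n<Suc N. a n / e ^ n)"
  have "a n \<le> C * e ^ n" for n
  proof (cases "n < Suc N")
    case True
    then have "a n / e ^ n \<le> (\<Sum>n<Suc N. a n / e ^ n)"
      using a e by (intro member_le_sum) auto
    then have "a n / e ^ n \<le> C"
      by (simp add: C_def)
    then show ?thesis
      using e by (simp add: field_simps)
  next
    case False
    then have "root n (a n) ^ n \<le> e ^ n"
      using N[of n] a by (intro power_mono) auto
    then have "a n \<le> 1 * e ^ n"
      using False a by simp
    also have "\<dots> \<le> C * e ^ n"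
      using a e by (intro mult_right_mono) (simp_all add: C_def sum_nonneg del: sum.lessThan_Suc)
    finally show ?thesis .
  qed
  then show "\<exists>C. \<forall>n. a n \<le> C * e ^ n" by blast
next
  assume *: "\<forall>e>0. \<exists>C. \<forall>n. a n \<le> C * e ^ n"
  show "(\<lambda>n. root n (a n)) \<longlonglongrightarrow> 0"
  proof (rule order_tendstoI)
    fix e :: real assume e: "e > 0"
    \<comment> \<open>Ratio \<open>e / 2\<close> leaves room for the root of the constant. Below,
      \<open>\<bar>C\<bar> + 1\<close> replaces \<open>C\<close> to have a positive
      constant.\<close>
    then obtain C where C: "\<And>n. a n \<le> C * (e / 2) ^ n"
      using * by (meson half_gt_zero)
    have "(\<lambda>n. root n (\<bar>C\<bar> + 1) * (e / 2)) \<longlonglongrightarrow> 1 * (e / 2)"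
      by (intro tendsto_mult tendsto_const LIMSEQ_root_const) auto
    then have "\<forall>\<^sub>F n in sequentially. root n (\<bar>C\<bar> + 1) * (e / 2) < e"
      by (rule order_tendstoD) (use e in simp)
    moreover have "\<forall>\<^sub>F n in sequentially. n > (0::nat)"
      by (rule eventually_gt_at_top)
    ultimately show "\<forall>\<^sub>F n in sequentially. root n (a n) < e"
    proof eventually_elim
      case (elim n)
      have "C * (e / 2) ^ n \<le> (\<bar>C\<bar> + 1) * (e / 2) ^ n"
        using e by (intro mult_right_mono) auto
      then have "root n (a n) \<le> root n ((\<bar>C\<bar> + 1) * (e / 2) ^ n)"
        using C[of n] elim by (intro real_root_le_mono) auto
      also have "root n ((\<bar>C\<bar> + 1) * (e / 2) ^ n) = root n (\<bar>C\<bar> + 1) * (e / 2)"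
        using elim e by (simp add: real_root_mult real_root_power_cancel)
      also have "\<dots> < e"
        by (rule elim)
      finally show ?case .
    qed
  next
    fix e :: real assume "e < 0"
    then show "\<forall>\<^sub>F n in sequentially. e < root n (a n)"
      using a by (intro always_eventually allI) (meson less_le_trans real_root_ge_zero)
  qed
qed

lemma mem_quasi_nilpotent_part_iff:
  "x \<in> H\<^sub>0 T \<longleftrightarrow> (\<forall>e>0. \<exists>C. \<forall>n. norm ((T ^^ n) x) \<le> C * e ^ n)"
  by (simp add: quasi_nilpotent_part_def root_tendsto_0_iff)

section \<open>Algebra of bounded operators on a subspace\<close>

lemma complex_subspace_imp_subspace:
  "complex_vector.subspace M \<Longrightarrow> subspace M"
  by (auto simp: subspace_def complex_vector.subspace_def scaleR_scaleC)

lemma bounded_operators_image: "A \<in> \<B> Y \<Longrightarrow> x \<in> Y \<Longrightarrow> A x \<in> Y"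
  by (auto simp: bounded_operators_def)

text \<open>The constant in the definition of \<open>\<B>\<close> can be negative when
  \<open>Y\<close> has no nonzero vector; its absolute value serves as well.\<close>

lemma bounded_operators_bound:
  assumes "A \<in> \<B> Y"
  obtains K where "K \<ge> 0" "\<And>x. x \<in> Y \<Longrightarrow> norm (A x) \<le> K * norm x"
proof -
  obtain K where K: "\<And>x. x \<in> Y \<Longrightarrow> norm (A x) \<le> K * norm x"
    using assms unfolding bounded_operators_def by blast
  have "norm (A x) \<le> \<bar>K\<bar> * norm x" if "x \<in> Y" for x
    using K[OF that] mult_right_mono[OF abs_ge_self norm_ge_zero] by (rule order_trans)
  then show ?thesis
    by (intro that[of "\<bar>K\<bar>"]) auto
qed

lemma bounded_operators_id: "(\<lambda>x. x) \<in> \<B> Y"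
  unfolding bounded_operators_def by (auto intro: exI[of _ 1])

lemma bounded_operators_comp:
  assumes "A \<in> \<B> Y" "B \<in> \<B> Y"
  shows "(\<lambda>x. A (B x)) \<in> \<B> Y"
proof -
  obtain K where K: "K \<ge> 0" "\<And>x. x \<in> Y \<Longrightarrow> norm (A x) \<le> K * norm x"
    using assms bounded_operators_bound by blast
  obtain L where L: "L \<ge> 0" "\<And>x. x \<in> Y \<Longrightarrow> norm (B x) \<le> L * norm x"
    using assms bounded_operators_bound by blast
  have "norm (A (B x)) \<le> (K * L) * norm x" if "x \<in> Y" for x
    using K(2)[of "B x"] mult_left_mono[OF L(2)[OF that] K(1)] assms that
    by (simp add: bounded_operators_image mult.assoc)
  then have "\<exists>K. \<forall>x\<in>Y. norm (A (B x)) \<le> K * norm x"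
    by blast
  then show ?thesis
    using assms unfolding bounded_operators_def by (auto simp: image_subset_iff)
qed

lemma bounded_operators_add:
  assumes Y: "complex_vector.subspace Y" and AB: "A \<in> \<B> Y" "B \<in> \<B> Y"
  shows "(\<lambda>x. A x + B x) \<in> \<B> Y"
proof -
  obtain K where K: "\<And>x. x \<in> Y \<Longrightarrow> norm (A x) \<le> K * norm x"
    using AB bounded_operators_bound by blast
  obtain L where L: "\<And>x. x \<in> Y \<Longrightarrow> norm (B x) \<le> L * norm x"
    using AB bounded_operators_bound by blast
  have "norm (A x + B x) \<le> (K + L) * norm x" if "x \<in> Y" for x
    using norm_triangle_mono[OF K[OF that] L[OF that]] by (simp add: algebra_simps)
  then have "\<exists>K. \<forall>x\<in>Y. norm (A x + B x) \<le> K * norm x"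
    by blast
  then show ?thesis
    using AB Y unfolding bounded_operators_def
    by (auto simp: image_subset_iff scaleC_add_right complex_vector.subspace_add)
qed

lemma bounded_operators_uminus:
  assumes Y: "complex_vector.subspace Y" and A: "A \<in> \<B> Y"
  shows "(\<lambda>x. - A x) \<in> \<B> Y"
  using A complex_vector.subspace_neg[OF Y]
  unfolding bounded_operators_def by (auto simp: image_subset_iff)

lemma bounded_operators_diff:
  assumes Y: "complex_vector.subspace Y" and AB: "A \<in> \<B> Y" "B \<in> \<B> Y"
  shows "(\<lambda>x. A x - B x) \<in> \<B> Y"
  using bounded_operators_add[OF Y AB(1) bounded_operators_uminus[OF Y AB(2)]] by simp

lemma bounded_operators_funpow:
  assumes "A \<in> \<B> Y"
  shows "A ^^ n \<in> \<B> Y"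
proof (induction n)
  case (Suc n)
  then show ?case
    using bounded_operators_comp[OF assms Suc] by (simp add: comp_def)
qed (simp add: bounded_operators_id id_def)

lemma bounded_operators_subset:
  assumes "A \<in> \<B> UNIV" "A ` Y \<subseteq> Y"
  shows "A \<in> \<B> Y"
  using assms unfolding bounded_operators_def by auto

lemma bounded_operators_UNIV_simps:
  assumes "A \<in> \<B> UNIV"
  shows "A (x + y) = A x + A y" "A (x - y) = A x - A y" "A (- x) = - A x" "A 0 = 0"
    "A (c *\<^sub>C x) = c *\<^sub>C A x"
  using assms linear_simps[of A] by (auto simp: bounded_operators_UNIV)

section \<open>The quasi-nilpotent part as an invariant subspace\<close>

lemma subspace_quasi_nilpotent_part:
  assumes T: "T \<in> \<B> UNIV"
  shows "complex_vector.subspace (H\<^sub>0 T)"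
  unfolding complex_vector.subspace_def
proof (intro conjI ballI allI)
  note lin = bounded_operators_UNIV_simps[OF bounded_operators_funpow[OF T]]
  show "0 \<in> H\<^sub>0 T"
    by (auto simp: mem_quasi_nilpotent_part_iff lin intro: exI[of _ 0])
  fix x assume x: "x \<in> H\<^sub>0 T"
  show "c *\<^sub>C x \<in> H\<^sub>0 T" for c
    unfolding mem_quasi_nilpotent_part_iff
  proof (intro allI impI)
    fix e :: real assume "e > 0"
    then obtain C where C: "\<And>n. norm ((T ^^ n) x) \<le> C * e ^ n"
      using x by (auto simp: mem_quasi_nilpotent_part_iff)
    show "\<exists>C. \<forall>n. norm ((T ^^ n) (c *\<^sub>C x)) \<le> C * e ^ n"
      using mult_left_mono[OF C norm_ge_zero[of c]]
      by (intro exI[of _ "norm c * C"]) (simp add: lin norm_scaleC mult.assoc)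
  qed
  fix y assume y: "y \<in> H\<^sub>0 T"
  show "x + y \<in> H\<^sub>0 T"
    unfolding mem_quasi_nilpotent_part_iff
  proof (intro allI impI)
    fix e :: real assume e: "e > 0"
    obtain C where C: "\<And>n. norm ((T ^^ n) x) \<le> C * e ^ n"
      using x e by (auto simp: mem_quasi_nilpotent_part_iff)
    obtain D where D: "\<And>n. norm ((T ^^ n) y) \<le> D * e ^ n"
      using y e by (auto simp: mem_quasi_nilpotent_part_iff)
    show "\<exists>C. \<forall>n. norm ((T ^^ n) (x + y)) \<le> C * e ^ n"
      using norm_triangle_mono[OF C D]
      by (intro exI[of _ "C + D"]) (simp add: lin distrib_right)
  qed
qed

text \<open>The orbit of \<open>T x\<close> is the orbit of \<open>x\<close> shifted by one, which
  only multiplies the constant by \<open>e\<close>.\<close>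

lemma quasi_nilpotent_part_image:
  "T ` H\<^sub>0 T \<subseteq> H\<^sub>0 T"
proof (clarsimp simp: mem_quasi_nilpotent_part_iff)
  fix x :: 'a and e :: real
  assume e: "e > 0" and x: "\<forall>e>0. \<exists>C. \<forall>n. norm ((T ^^ n) x) \<le> C * e ^ n"
  then obtain C where C: "\<And>n. norm ((T ^^ n) x) \<le> C * e ^ n"
    by blast
  have "norm ((T ^^ n) (T x)) \<le> (C * e) * e ^ n" for n
    using C[of "Suc n"] by (simp add: funpow_swap1 mult.assoc)
  then show "\<exists>C. \<forall>n. norm ((T ^^ n) (T x)) \<le> C * e ^ n"
    by blast
qed

section \<open>Operator norms and quasi-nilpotency on a subspace\<close>

lemma bdd_above_operator_ratio:
  assumes "A \<in> \<B> Y"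
  shows "bdd_above ((\<lambda>x. norm (A x) / norm x) ` Y)"
proof -
  obtain K where K: "K \<ge> 0" "\<And>x. x \<in> Y \<Longrightarrow> norm (A x) \<le> K * norm x"
    using assms bounded_operators_bound by blast
  have "norm (A y) / norm y \<le> K" if "y \<in> Y" for y
    using K that by (cases "y = 0") (auto simp: field_simps)
  then show ?thesis
    by (rule bdd_aboveI2)
qed

lemma onorm_on_bound:
  assumes A: "A \<in> \<B> Y" and x: "x \<in> Y"
  shows "norm (A x) \<le> onorm_on Y A * norm x"
proof (cases "x = 0")
  case True
  \<comment> \<open>At the zero vector the quotient in \<open>onorm_on\<close> is 0 by convention
    and carries no information, so \<open>A 0 = 0\<close> comes from homogeneity.\<close>
  have "A (0 *\<^sub>C x) = 0 *\<^sub>C A x"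
    using A x unfolding bounded_operators_def by blast
  then show ?thesis
    using True by simp
next
  case False
  have "norm (A x) / norm x \<le> onorm_on Y A"
    unfolding onorm_on_def by (rule cSUP_upper[OF x bdd_above_operator_ratio[OF A]])
  then show ?thesis
    using False by (simp add: field_simps)
qed

lemma onorm_on_nonneg:
  assumes "A \<in> \<B> Y" "Y \<noteq> {}"
  shows "onorm_on Y A \<ge> 0"
proof -
  obtain x where "x \<in> Y"
    using assms by blast
  then show ?thesis
    unfolding onorm_on_def
    by (intro cSUP_upper2[OF bdd_above_operator_ratio[OF assms(1)]]) auto
qed

lemma onorm_on_le:
  assumes "Y \<noteq> {}" "K \<ge> 0" "\<And>x. x \<in> Y \<Longrightarrow> norm (A x) \<le> K * norm x"
  shows "onorm_on Y A \<le> K"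
  unfolding onorm_on_def
proof (rule cSUP_least[OF assms(1)])
  show "norm (A x) / norm x \<le> K" if "x \<in> Y" for x
    using assms(2) assms(3)[OF that] by (cases "x = 0") (auto simp: field_simps)
qed

text \<open>The uniform counterpart of \<open>mem_quasi_nilpotent_part_iff\<close>: one constant
  serves all vectors of \<open>Y\<close>. Nonemptiness gives the supremum in \<open>onorm_on\<close>
  a meaning.\<close>

lemma quasi_nilpotent_on_iff:
  assumes A: "A \<in> \<B> Y" and Y: "Y \<noteq> {}"
  shows "quasi_nilpotent_on Y A \<longleftrightarrow>
    (\<forall>e>0. \<exists>C. \<forall>n. \<forall>x\<in>Y. norm ((A ^^ n) x) \<le> C * e ^ n * norm x)"
proof -
  note An = bounded_operators_funpow[OF A]
  have "quasi_nilpotent_on Y A \<longleftrightarrow> (\<forall>e>0. \<exists>C. \<forall>n. onorm_on Y (A ^^ n) \<le> C * e ^ n)"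
    using A Y by (simp add: quasi_nilpotent_on_def root_tendsto_0_iff onorm_on_nonneg An)
  also have "\<dots> \<longleftrightarrow> (\<forall>e>0. \<exists>C. \<forall>n. \<forall>x\<in>Y. norm ((A ^^ n) x) \<le> C * e ^ n * norm x)"
  proof (intro all_cong1 imp_cong[OF refl] iffI)
    fix e :: real assume "\<exists>C. \<forall>n. onorm_on Y (A ^^ n) \<le> C * e ^ n"
    then obtain C where C: "\<And>n. onorm_on Y (A ^^ n) \<le> C * e ^ n"
      by blast
    show "\<exists>C. \<forall>n. \<forall>x\<in>Y. norm ((A ^^ n) x) \<le> C * e ^ n * norm x"
      using order_trans[OF onorm_on_bound[OF An] mult_right_mono[OF C norm_ge_zero]] by blast
  next
    fix e :: real assume e: "e > 0" and "\<exists>C. \<forall>n. \<forall>x\<in>Y. norm ((A ^^ n) x) \<le> C * e ^ n * norm x"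
    then obtain C where C: "\<And>n x. x \<in> Y \<Longrightarrow> norm ((A ^^ n) x) \<le> C * e ^ n * norm x"
      by blast
    have "onorm_on Y (A ^^ n) \<le> \<bar>C\<bar> * e ^ n" for n
    proof (rule onorm_on_le[OF Y])
      fix x assume x: "x \<in> Y"
      have "C * e ^ n * norm x \<le> \<bar>C\<bar> * e ^ n * norm x"
        using e by (intro mult_right_mono) auto
      then show "norm ((A ^^ n) x) \<le> \<bar>C\<bar> * e ^ n * norm x"
        using C[OF x, of n] by simp
    qed (use e in auto)
    then show "\<exists>C. \<forall>n. onorm_on Y (A ^^ n) \<le> C * e ^ n" by blast
  qed
  finally show ?thesis .
qed

lemma quasi_nilpotent_on_uminus:
  assumes "quasi_nilpotent_on UNIV Q"
  shows "quasi_nilpotent_on UNIV (\<lambda>x. - Q x)"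
proof -
  have Q: "Q \<in> \<B> UNIV"
    using assms by (simp add: quasi_nilpotent_on_def)
  \<comment> \<open>Leaving the sign undetermined avoids a distinction by the parity of
    \<open>n\<close>; the norm does not see it.\<close>
  have "((\<lambda>x. - Q x) ^^ n) x \<in> {(Q ^^ n) x, - (Q ^^ n) x}" for n x
    by (induction n) (auto simp: bounded_operators_UNIV_simps[OF Q])
  then have "norm (((\<lambda>x. - Q x) ^^ n) x) = norm ((Q ^^ n) x)" for n x
    by (metis insertE norm_minus_cancel singletonD)
  then show ?thesis
    using assms Q by (simp add: quasi_nilpotent_on_iff bounded_operators_uminus complex_vector.subspace_UNIV)
qed

text \<open>The series over the powers of \<open>q = - Q\<close> converges absolutely, since
  quasi-nilpotency with ratio 1/2 dominates it by a geometric series. Splitting off its first term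
  gives \<open>R x = x + R (q x)\<close>, which is the claim.\<close>

lemma Neumann_inverse:
  fixes Q :: "'a::complex_banach \<Rightarrow> 'a"
  assumes "quasi_nilpotent_on UNIV Q"
  shows "\<exists>R\<in>\<B> UNIV. \<forall>x. R (x + Q x) = x"
proof -
  define q where "q = (\<lambda>x. - Q x)"
  have qn: "quasi_nilpotent_on UNIV q"
    unfolding q_def by (rule quasi_nilpotent_on_uminus[OF assms])
  then have q: "q \<in> \<B> UNIV"
    by (simp add: quasi_nilpotent_on_def)
  note lin = bounded_operators_UNIV_simps[OF bounded_operators_funpow[OF q]]
  obtain C where C: "\<And>n x. norm ((q ^^ n) x) \<le> C * (1/2) ^ n * norm x"
    using qn unfolding quasi_nilpotent_on_iff[OF q UNIV_not_empty]
    by (metis UNIV_I half_gt_zero_iff zero_less_one)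
  have geo: "(\<lambda>n. C * (1/2) ^ n * norm x) sums (C * (1 / (1 - 1/2)) * norm x)" for x
    by (intro sums_mult sums_mult2 geometric_sums) auto
  have sn: "summable (\<lambda>n. norm ((q ^^ n) x))" for x
    by (rule summable_comparison_test'[OF sums_summable[OF geo], where N = 0]) (use C in auto)
  have s: "summable (\<lambda>n. (q ^^ n) x)" for x
    by (rule summable_norm_cancel[OF sn])
  define R where "R = (\<lambda>x. \<Sum>n. (q ^^ n) x)"
  have add: "R (x + y) = R x + R y" for x y
    by (simp add: R_def lin suminf_add[OF s s])
  have "norm (R x) \<le> (2 * C) * norm x" for x
  proof -
    have "norm (R x) \<le> (\<Sum>n. norm ((q ^^ n) x))"
      unfolding R_def by (rule summable_norm[OF sn])
    also have "\<dots> \<le> (\<Sum>n. C * (1/2) ^ n * norm x)"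
      by (intro suminf_le sn sums_summable[OF geo] C)
    also have "\<dots> = (2 * C) * norm x"
      using sums_unique[OF geo[of x]] by simp
    finally show ?thesis .
  qed
  moreover have "R (c *\<^sub>C x) = c *\<^sub>C R x" for c x
  proof -
    \<comment> \<open>Complex scalar multiplication is bounded and real-linear, hence passes through
      the series.\<close>
    have "bounded_linear ((*\<^sub>C) c :: 'a \<Rightarrow> 'a)"
      by (rule bounded_linear_intro[of _ "cmod c"])
        (auto simp: scaleC_add_right norm_scaleC scaleR_scaleC scaleC_scaleC mult.commute)
    then show ?thesis
      unfolding R_def by (simp add: lin bounded_linear.suminf[OF _ s])
  qed
  ultimately have "R \<in> \<B> UNIV"
    unfolding bounded_operators_def using add by blast
  moreover have "R (x + Q x) = x" for x
  proof -
    have "R x = (\<Sum>n. (q ^^ Suc n) x) + x"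
      unfolding R_def using suminf_split_head[OF s, of x] by simp
    also have "(\<Sum>n. (q ^^ Suc n) x) = R (q x)"
      by (simp add: R_def funpow_swap1)
    finally show ?thesis
      using add[of "x + Q x" "q x"] by (simp add: q_def)
  qed
  ultimately show ?thesis by blast
qed

subsection \<open>Decompositions reducing an operator\<close>

text \<open>Uniqueness of the decomposition makes the component map complex linear, and
  \<open>direct_sum_component_bounded\<close> makes it bounded. The inclusion
  \<open>M \<subseteq> Y\<close> turns it into an operator on \<open>Y\<close>.\<close>

lemma direct_sum_component_operator:
  fixes A :: "'a::complex_banach \<Rightarrow> 'a"
  assumes A: "A \<in> \<B> UNIV"
    and closed: "closed_subspace M" "closed_subspace W" "closed_subspace Y"
    and Y_eq: "Y = {A m + w | m w. m \<in> M \<and> w \<in> W}" and "M \<subseteq> Y"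
    and inj: "\<And>m w. \<lbrakk>m \<in> M; w \<in> W; A m + w = 0\<rbrakk> \<Longrightarrow> m = 0"
  shows "\<exists>g\<in>\<B> Y. \<forall>m\<in>M. \<forall>w\<in>W. g (A m + w) = m"
proof -
  note lin = bounded_operators_UNIV_simps[OF A]
  have sub: "complex_vector.subspace M" "complex_vector.subspace W"
    using closed by (simp_all add: closed_subspace_def)
  define g where "g = (\<lambda>y. THE m. m \<in> M \<and> (\<exists>w\<in>W. y = A m + w))"
  have g: "g (A m + w) = m" if "m \<in> M" "w \<in> W" for m w
    unfolding g_def
  proof (rule the_equality)
    fix m' assume "m' \<in> M \<and> (\<exists>w'\<in>W. A m + w = A m' + w')"
    then obtain w' where w': "m' \<in> M" "w' \<in> W" "A m + w = A m' + w'"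
      by blast
    have "A (m' - m) + (w' - w) = 0"
      using w' by (simp add: lin algebra_simps)
    then have "m' - m = 0"
      using inj[of "m' - m" "w' - w"] w' that sub by (simp add: complex_vector.subspace_diff)
    then show "m' = m" by simp
  qed (use that in blast)
  have "\<exists>K. \<forall>m\<in>M. \<forall>w\<in>W. norm m \<le> K * norm (A m + w)"
    using A closed
    by (intro direct_sum_component_bounded[OF _ _ _ _ _ _ _ Y_eq inj])
      (auto simp: bounded_operators_UNIV closed_subspace_def complex_subspace_imp_subspace)
  then obtain K where K: "\<And>m w. m \<in> M \<Longrightarrow> w \<in> W \<Longrightarrow> norm m \<le> K * norm (A m + w)"
    by blast
  have "g (x + y) = g x + g y" if xy: "x \<in> Y" "y \<in> Y" for x y
  proof -
    obtain m w m' w' where *: "m \<in> M" "w \<in> W" "x = A m + w" "m' \<in> M" "w' \<in> W" "y = A m' + w'"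
      using xy Y_eq by blast
    then have "x + y = A (m + m') + (w + w')"
      by (simp add: lin algebra_simps)
    moreover have "g (A (m + m') + (w + w')) = m + m'"
      using * g sub by (simp add: complex_vector.subspace_add)
    ultimately show ?thesis
      using g[OF *(1,2)] g[OF *(4,5)] *(3,6) by metis
  qed
  moreover have "g (c *\<^sub>C x) = c *\<^sub>C g x" if x: "x \<in> Y" for c x
  proof -
    obtain m w where *: "m \<in> M" "w \<in> W" "x = A m + w"
      using x Y_eq by blast
    then have "c *\<^sub>C x = A (c *\<^sub>C m) + c *\<^sub>C w"
      by (simp add: lin scaleC_add_right)
    moreover have "g (A (c *\<^sub>C m) + c *\<^sub>C w) = c *\<^sub>C m"
      using * g sub by (simp add: complex_vector.subspace_scale)
    ultimately show ?thesis
      using g[OF *(1,2)] *(3) by metis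
  qed
  moreover have "g ` Y \<subseteq> Y"
    using g \<open>M \<subseteq> Y\<close> by (auto simp: Y_eq)
  moreover have "\<forall>x\<in>Y. norm (g x) \<le> K * norm x"
    using g K by (auto simp: Y_eq)
  ultimately have "g \<in> \<B> Y"
    unfolding bounded_operators_def by blast
  then show ?thesis
    using g by blast
qed

lemma topological_direct_sum_decomp:
  assumes "topological_direct_sum Y M N" "x \<in> Y"
  obtains m n where "m \<in> M" "n \<in> N" "x = m + n"
  using assms unfolding topological_direct_sum_def by blast

text \<open>The component lemma with the identity for \<open>A\<close>; the summands swap roles,
  because the projection goes onto \<open>N\<close> along \<open>M\<close>.\<close>

lemma direct_sum_projection:
  fixes M N :: "'a::complex_banach set"
  assumes sum: "topological_direct_sum UNIV M N"
  shows "\<exists>P\<in>\<B> UNIV. \<forall>n\<in>N. \<forall>m\<in>M. P (n + m) = n"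
proof (rule direct_sum_component_operator[OF bounded_operators_id])
  have closed: "closed_subspace M" "closed_subspace N" and int: "M \<inter> N = {0}"
    using sum by (simp_all add: topological_direct_sum_def)
  show "closed_subspace M" "closed_subspace N"
    by (rule closed)+
  show "closed_subspace (UNIV :: 'a set)"
    by (simp add: closed_subspace_def complex_vector.subspace_UNIV)
  have "\<exists>n m. x = n + m \<and> n \<in> N \<and> m \<in> M" for x
    using topological_direct_sum_decomp[OF sum UNIV_I, of x] add.commute by metis
  then show "(UNIV :: 'a set) = {n + m | n m. n \<in> N \<and> m \<in> M}"
    by (simp add: set_eq_iff)
  fix n m assume *: "n \<in> N" "m \<in> M" "n + m = 0"
  then have "n = - m"
    by (simp add: eq_neg_iff_add_eq_0)
  then have "n \<in> M"
    using * closed complex_vector.subspace_neg by (auto simp: closed_subspace_def)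
  then show "n = 0"
    using * int by blast
qed simp

text \<open>Commuting with \<open>T\<close>, \<open>P\<close> fixes the whole orbit of each of its
  fixed points, so inserting it between the factors changes nothing.\<close>

lemma funpow_comp_projection:
  assumes "T \<circ> P = P \<circ> T" "P x = x"
  shows "((T \<circ> P) ^^ n) x = (T ^^ n) x" "P ((T ^^ n) x) = (T ^^ n) x"
proof -
  have comm: "P (T y) = T (P y)" for y
    using fun_cong[OF assms(1), of y] by simp
  show *: "P ((T ^^ n) x) = (T ^^ n) x" for n
    by (induction n) (simp_all add: assms comm)
  show "((T \<circ> P) ^^ n) x = (T ^^ n) x"
    by (induction n) (simp_all add: *)
qed

text \<open>\<open>P\<close> projects onto \<open>N\<close> along \<open>M\<close>, and
  \<open>S\<close> inverts \<open>T\<close> on \<open>M\<close> and vanishes on \<open>N\<close>.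
  Then \<open>T \<circ> P\<close> is 0 on \<open>M\<close> and \<open>T\<close> on
  \<open>N\<close>.\<close>

lemma reduce_imp_projection:
  fixes T :: "'a::complex_banach \<Rightarrow> 'a"
  assumes T: "T \<in> \<B> UNIV" and red: "reduce M N T"
    and left: "left_invertible_on M T" and qn: "quasi_nilpotent_on N T"
  obtains P S where "projection P" "T \<circ> P = P \<circ> T" "S \<in> \<B> UNIV"
    "\<And>x. S (T x) = x - P x" "\<And>x. S (P x) = 0" "quasi_nilpotent_on UNIV (T \<circ> P)"
proof -
  have sum: "topological_direct_sum UNIV M N"
    and M: "complex_vector.subspace M" and N: "complex_vector.subspace N"
    and TM: "T ` M \<subseteq> M" and TN: "T ` N \<subseteq> N"
    using red unfolding reduce_def topological_direct_sum_def closed_subspace_def by blast+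
  note linT = bounded_operators_UNIV_simps[OF T]
  obtain P where P: "P \<in> \<B> UNIV" and Pnm: "\<And>n m. n \<in> N \<Longrightarrow> m \<in> M \<Longrightarrow> P (n + m) = n"
    using direct_sum_projection[OF sum] by blast
  note linP = bounded_operators_UNIV_simps[OF P]
  have dec: "\<exists>n\<in>N. \<exists>m\<in>M. x = n + m" for x
    using topological_direct_sum_decomp[OF sum, of x] by (metis UNIV_I add.commute)
  have PN: "P x \<in> N" and IPM: "x - P x \<in> M" for x
    using dec[of x] Pnm by auto
  have P_on_N: "P n = n" if "n \<in> N" for n
    using Pnm[OF that complex_vector.subspace_0[OF M]] by simp
  have proj: "projection P"
    using P PN P_on_N by (auto simp: projection_def)
  have commx: "T (P x) = P (T x)" for x
  proof -
    obtain n m where nm: "n \<in> N" "m \<in> M" "x = n + m"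
      using dec by blast
    then have "T n \<in> N" "T m \<in> M"
      using TN TM by auto
    then show ?thesis
      using nm by (simp add: linT Pnm)
  qed
  then have comm: "T \<circ> P = P \<circ> T"
    by auto
  obtain B where B: "B \<in> \<B> M" and BT: "\<And>x. x \<in> M \<Longrightarrow> B (T x) = x"
    using left unfolding left_invertible_on_def by blast
  \<comment> \<open>\<open>B\<close> is controlled only on \<open>M\<close>, so its argument is
    first projected there.\<close>
  define S where "S = (\<lambda>x. B (x - P x))"
  have IP: "(\<lambda>x. x - P x) \<in> \<B> UNIV"
    by (rule bounded_operators_diff[OF complex_vector.subspace_UNIV bounded_operators_id P])
  have S: "S \<in> \<B> UNIV"
  proof -
    obtain K where K: "K \<ge> 0" "\<And>x. x \<in> M \<Longrightarrow> norm (B x) \<le> K * norm x"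
      using B bounded_operators_bound by blast
    obtain L where L: "L \<ge> 0" "\<And>x. x \<in> UNIV \<Longrightarrow> norm (x - P x) \<le> L * norm x"
      using IP bounded_operators_bound by blast
    have "norm (S x) \<le> (K * L) * norm x" for x
      using order_trans[OF K(2)[OF IPM[of x]] mult_left_mono[OF L(2)[OF UNIV_I] K(1)]]
      by (simp only: S_def mult.assoc)
    then have "\<exists>K. \<forall>x\<in>UNIV. norm (S x) \<le> K * norm x"
      by blast
    moreover have "S (x + y) = S x + S y" for x y
    proof -
      have "S (x + y) = B ((x - P x) + (y - P y))"
        by (simp add: S_def linP algebra_simps)
      then show ?thesis
        using B IPM unfolding bounded_operators_def S_def by auto
    qed
    moreover have "S (c *\<^sub>C x) = c *\<^sub>C S x" for c x
    proof -
      have "S (c *\<^sub>C x) = B (c *\<^sub>C (x - P x))"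
        by (simp add: S_def linP complex_vector.scale_right_diff_distrib)
      then show ?thesis
        using B IPM unfolding bounded_operators_def S_def by auto
    qed
    ultimately show ?thesis
      unfolding bounded_operators_def by blast
  qed
  have ST: "S (T x) = x - P x" for x
    using BT[OF IPM] by (simp add: S_def linT commx)
  have SP: "S (P x) = 0" for x
    using linP(4) P_on_N[OF PN] bounded_operators_UNIV_simps(4)[OF S] by (simp add: S_def)
  have TP: "T \<circ> P \<in> \<B> UNIV"
    using bounded_operators_comp[OF T P] by (simp add: comp_def)
  have "quasi_nilpotent_on UNIV (T \<circ> P)"
    unfolding quasi_nilpotent_on_iff[OF TP UNIV_not_empty]
  proof (intro allI impI)
    fix e :: real assume e: "e > 0"
    have TN': "T \<in> \<B> N" "N \<noteq> {}"
      using qn complex_vector.subspace_0[OF N] by (auto simp: quasi_nilpotent_on_def)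
    obtain C where C: "\<And>n x. x \<in> N \<Longrightarrow> norm ((T ^^ n) x) \<le> C * e ^ n * norm x"
      using qn e unfolding quasi_nilpotent_on_iff[OF TN'] by blast
    obtain K where K: "K \<ge> 0" "\<And>x. x \<in> UNIV \<Longrightarrow> norm (P x) \<le> K * norm x"
      using P bounded_operators_bound by blast
    \<comment> \<open>The power 0 is the identity and not \<open>P\<close>, hence the summand 1 in
      the constant.\<close>
    have "norm (((T \<circ> P) ^^ n) x) \<le> (\<bar>C\<bar> * K + 1) * e ^ n * norm x" for n x
    proof (cases n)
      case 0
      then show ?thesis
        using K by (simp add: distrib_right)
    next
      case (Suc k)
      \<comment> \<open>Idempotence of \<open>P\<close> allows \<open>x\<close> to be replaced by
        \<open>P x\<close> in a positive power; on \<open>N\<close> that power is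
        \<open>T ^^ n\<close>.\<close>
      have "((T \<circ> P) ^^ Suc k) x = ((T \<circ> P) ^^ k) ((T \<circ> P) (P x))"
        using P_on_N[OF PN, of x] by (simp add: funpow_swap1)
      also have "\<dots> = ((T \<circ> P) ^^ Suc k) (P x)"
        by (simp only: funpow_Suc_right o_apply)
      also have "\<dots> = (T ^^ n) (P x)"
        by (simp only: funpow_comp_projection(1)[OF comm P_on_N[OF PN]] Suc)
      finally have "norm (((T \<circ> P) ^^ n) x) = norm ((T ^^ n) (P x))"
        using Suc by simp
      also have "\<dots> \<le> C * e ^ n * norm (P x)"
        by (rule C[OF PN])
      also have "\<dots> \<le> \<bar>C\<bar> * e ^ n * (K * norm x)"
        using e K by (intro mult_mono) auto
      also have "\<dots> \<le> (\<bar>C\<bar> * K + 1) * e ^ n * norm x"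
        using e by (simp add: algebra_simps)
      finally show ?thesis .
    qed
    then show "\<exists>C. \<forall>n. \<forall>x\<in>UNIV. norm (((T \<circ> P) ^^ n) x) \<le> C * e ^ n * norm x"
      by blast
  qed
  then show ?thesis
    by (rule that[OF proj comm S ST SP])
qed

text \<open>The kernel and the range of \<open>P\<close> reduce \<open>T\<close>. Asking that
  \<open>S\<close> undo \<open>T\<close> only on the kernel covers both the operator of (i) and a
  left inverse of \<open>T + P\<close> from (ii).\<close>

lemma projection_imp_reduce:
  fixes T :: "'a::complex_banach \<Rightarrow> 'a"
  assumes T: "T \<in> \<B> UNIV" and proj: "projection P" and comm: "T \<circ> P = P \<circ> T"
    and S: "S \<in> \<B> UNIV" and ST: "\<And>x. P x = 0 \<Longrightarrow> S (T x) = x"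
    and qn: "quasi_nilpotent_on UNIV (T \<circ> P)"
  shows "\<exists>M N. reduce M N T \<and> left_invertible_on M T \<and> quasi_nilpotent_on N T"
proof -
  define M where "M = {x. P x = 0}"
  \<comment> \<open>The range of \<open>P\<close>, written as its fixed points to be closed as a set
    where two continuous maps agree.\<close>
  define N where "N = {x. P x = x}"
  have P: "P \<in> \<B> UNIV" and PP: "P (P x) = P x" for x
    using proj by (auto simp: projection_def fun_eq_iff)
  have commx: "T (P x) = P (T x)" for x
    using comm by (simp add: fun_eq_iff)
  note linP = bounded_operators_UNIV_simps[OF P]
  note linT = bounded_operators_UNIV_simps[OF T]
  have cont: "continuous_on UNIV P"
    using P by (simp add: bounded_operators_UNIV linear_continuous_on)
  have "closed_subspace M"
    unfolding closed_subspace_def complex_vector.subspace_def M_def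
    by (auto simp: linP intro!: closed_Collect_eq cont continuous_on_const)
  moreover have "closed_subspace N"
    unfolding closed_subspace_def complex_vector.subspace_def N_def
    by (auto simp: linP intro!: closed_Collect_eq cont continuous_on_id)
  moreover have "UNIV = {m + n |m n. m \<in> M \<and> n \<in> N}"
  proof -
    have "x - P x \<in> M" "P x \<in> N" "x = (x - P x) + P x" for x
      by (simp_all add: M_def N_def linP PP)
    then show ?thesis by blast
  qed
  moreover have "M \<inter> N = {0}"
    by (auto simp: M_def N_def linP)
  moreover have TM: "T ` M \<subseteq> M" and TN: "T ` N \<subseteq> N"
    by (auto simp: M_def N_def linT simp flip: commx)
  ultimately have "reduce M N T"
    unfolding reduce_def topological_direct_sum_def by (intro conjI)
  moreover have "left_invertible_on M T"
  proof -
    \<comment> \<open>\<open>S\<close> may leave \<open>M\<close>, so its values are projected back;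
      on \<open>T\<close> \<open>M\<close> this changes nothing.\<close>
    have "(\<lambda>x. S x - P (S x)) \<in> \<B> UNIV"
      by (rule bounded_operators_diff[OF complex_vector.subspace_UNIV S bounded_operators_comp[OF P S]])
    moreover have "(\<lambda>x. S x - P (S x)) ` M \<subseteq> M"
      by (auto simp: M_def linP PP)
    ultimately have "(\<lambda>x. S x - P (S x)) \<in> \<B> M"
      by (rule bounded_operators_subset)
    then show ?thesis
      unfolding left_invertible_on_def using bounded_operators_subset[OF T TM]
      by (intro conjI bexI) (auto simp: M_def ST)
  qed
  moreover have "quasi_nilpotent_on N T"
  proof -
    have N: "T \<in> \<B> N" "N \<noteq> {}"
      using bounded_operators_subset[OF T TN] linP by (auto simp: N_def)
    have TP: "T \<circ> P \<in> \<B> UNIV"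
      using qn by (simp add: quasi_nilpotent_on_def)
    have "((T \<circ> P) ^^ n) x = (T ^^ n) x" if "x \<in> N" for n x
      using funpow_comp_projection[OF comm] that by (simp add: N_def)
    then show ?thesis
      using qn unfolding quasi_nilpotent_on_iff[OF TP UNIV_not_empty] quasi_nilpotent_on_iff[OF N]
      by (metis UNIV_I)
  qed
  ultimately show ?thesis by blast
qed

text \<open>\<open>N\<close> lies in \<open>H\<^sub>0 T\<close>, so the \<open>M\<close>-component
  of a vector of \<open>H\<^sub>0 T\<close> lies there too. It must vanish, since orbits in
  \<open>M\<close> cannot decay faster than every geometric sequence unless they start at 0.\<close>

lemma reduce_imp_quasi_nilpotent_part:
  assumes T: "T \<in> \<B> UNIV" and red: "reduce M N T"
    and left: "left_invertible_on M T" and qn: "quasi_nilpotent_on N T"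
  shows "H\<^sub>0 T = N"
proof
  have M: "complex_vector.subspace M" and N: "complex_vector.subspace N"
    and TM: "T ` M \<subseteq> M" and sum: "topological_direct_sum UNIV M N"
    using red unfolding reduce_def topological_direct_sum_def closed_subspace_def by blast+
  have TN': "T \<in> \<B> N" "N \<noteq> {}"
    using qn complex_vector.subspace_0[OF N] by (auto simp: quasi_nilpotent_on_def)
  show NH: "N \<subseteq> H\<^sub>0 T"
  proof
    fix x assume x: "x \<in> N"
    show "x \<in> H\<^sub>0 T"
      unfolding mem_quasi_nilpotent_part_iff
    proof (intro allI impI)
      fix e :: real assume "e > 0"
      then obtain C where C: "\<And>n x. x \<in> N \<Longrightarrow> norm ((T ^^ n) x) \<le> C * e ^ n * norm x"
        using qn unfolding quasi_nilpotent_on_iff[OF TN'] by blast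
      show "\<exists>C. \<forall>n. norm ((T ^^ n) x) \<le> C * e ^ n"
        using C[OF x] by (intro exI[of _ "C * norm x"]) (simp add: mult_ac)
    qed
  qed
  obtain B where B: "B \<in> \<B> M" and BT: "\<And>x. x \<in> M \<Longrightarrow> B (T x) = x"
    using left unfolding left_invertible_on_def by blast
  obtain K where K: "K \<ge> 0" "\<And>x. x \<in> M \<Longrightarrow> norm (B x) \<le> K * norm x"
    using B bounded_operators_bound by blast
  have zero: "m = 0" if m: "m \<in> M" "m \<in> H\<^sub>0 T" for m
  proof -
    have TnM: "(T ^^ n) m \<in> M" for n
      using m TM by (induction n) auto
    have le: "norm m \<le> K ^ n * norm ((T ^^ n) m)" for n
    proof (induction n)
      case (Suc n)
      have "norm ((T ^^ n) m) \<le> K * norm ((T ^^ Suc n) m)"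
        using K(2)[OF TnM[of "Suc n"]] BT[OF TnM] by simp
      then have "K ^ n * norm ((T ^^ n) m) \<le> K ^ n * (K * norm ((T ^^ Suc n) m))"
        using K by (intro mult_left_mono) auto
      then show ?case
        using Suc by (simp add: mult_ac)
    qed simp
    \<comment> \<open>Chosen for \<open>K * e \<le> 1/2\<close>; adding 1 to \<open>K\<close> keeps
      the denominator positive when \<open>K = 0\<close>.\<close>
    define e where "e = 1 / (2 * (K + 1))"
    have e: "e > 0" "K * e \<le> 1/2"
      using K by (auto simp: e_def field_simps)
    then obtain C where C: "\<And>n. norm ((T ^^ n) m) \<le> C * e ^ n"
      using m unfolding mem_quasi_nilpotent_part_iff by blast
    have "C \<ge> 0"
      using order_trans[OF norm_ge_zero C[of 0]] by simp
    have "norm m \<le> C * (1/2) ^ n" for n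
    proof -
      have "norm m \<le> K ^ n * (C * e ^ n)"
        using le[of n] mult_left_mono[OF C[of n], of "K ^ n"] K by simp
      also have "\<dots> = C * (K * e) ^ n"
        by (simp add: power_mult_distrib)
      also have "\<dots> \<le> C * (1/2) ^ n"
        using e K \<open>C \<ge> 0\<close> by (intro mult_left_mono power_mono) auto
      finally show ?thesis .
    qed
    moreover have "(\<lambda>n. C * (1/2) ^ n) \<longlonglongrightarrow> C * 0"
      by (intro tendsto_mult tendsto_const LIMSEQ_power_zero) auto
    ultimately have "norm m \<le> C * 0"
      by (intro LIMSEQ_le_const) auto
    then show ?thesis by simp
  qed
  show "H\<^sub>0 T \<subseteq> N"
  proof
    fix x assume x: "x \<in> H\<^sub>0 T"
    obtain m n where mn: "m \<in> M" "n \<in> N" "x = m + n"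
      using topological_direct_sum_decomp[OF sum, of x] by blast
    then have "x - n \<in> H\<^sub>0 T"
      using x NH complex_vector.subspace_diff[OF subspace_quasi_nilpotent_part[OF T]] by blast
    then show "x \<in> N"
      using zero[of m] mn by simp
  qed
qed

section \<open>Left invertibility and complemented ranges\<close>

lemma left_invertible_imp_range_complemented:
  assumes T: "T \<in> \<B> UNIV" and M: "closed_subspace M"
    and left: "left_invertible_on M T"
  shows "topologically_complemented_in M (T ` M)"
proof -
  have sub: "complex_vector.subspace M" and "closed M"
    using M by (auto simp: closed_subspace_def)
  have TM: "T \<in> \<B> M"
    using left by (simp add: left_invertible_on_def)
  obtain B where B: "B \<in> \<B> M" and BT: "\<And>x. x \<in> M \<Longrightarrow> B (T x) = x"
    using left unfolding left_invertible_on_def by blast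
  have linB: "B (x + y) = B x + B y" "B (c *\<^sub>C x) = c *\<^sub>C B x" if "x \<in> M" "y \<in> M" for x y c
    using B that by (auto simp: bounded_operators_def)
  have diffB: "B (x - y) = B x - B y" if "x \<in> M" "y \<in> M" for x y
    using linB(1)[of "x - y" y] that sub by (simp add: complex_vector.subspace_diff)
  note linT = bounded_operators_UNIV_simps[OF T]
  note mem = bounded_operators_image[OF B] bounded_operators_image[OF TM]
    complex_vector.subspace_0[OF sub] complex_vector.subspace_add[OF sub]
    complex_vector.subspace_diff[OF sub] complex_vector.subspace_scale[OF sub]
  have B0: "B 0 = 0"
    using diffB[of 0 0] mem by simp
  obtain K where K: "K \<ge> 0" "\<And>x. x \<in> M \<Longrightarrow> norm (B x) \<le> K * norm x"
    using B bounded_operators_bound by blast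
  \<comment> \<open>Outside \<open>M\<close> nothing is known about \<open>B\<close>, so continuity
    is taken relative to \<open>M\<close>.\<close>
  have contB: "continuous_on M B"
  proof (rule lipschitz_on_continuous_on)
    show "K-lipschitz_on M B"
      using K mem by (intro lipschitz_onI) (auto simp: dist_norm simp flip: diffB)
  qed
  have contT: "continuous_on UNIV T"
    using T by (simp add: bounded_operators_UNIV linear_continuous_on)
  define W where "W = {x \<in> M. B x = 0}"
  \<comment> \<open>On \<open>M\<close> the map \<open>T \<circ> B\<close> is idempotent with range
    \<open>T(M)\<close>: its fixed points form a closed set, and the kernel \<open>W\<close> of
    \<open>B\<close> is the complement.\<close>
  have "T ` M = {x \<in> M. T (B x) - x = 0}"
    using BT mem by (auto simp: image_iff) (metis mem(1))
  moreover have "closed {x \<in> M. T (B x) - x = 0}"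
    by (intro continuous_closed_preimage_constant continuous_intros \<open>closed M\<close>
        continuous_on_compose2[OF contT contB]) auto
  moreover have "complex_vector.subspace (T ` M)"
    unfolding complex_vector.subspace_def
    using mem linT by (auto simp: image_iff simp flip: linT(1,5))
  ultimately have "closed_subspace (T ` M)"
    by (simp add: closed_subspace_def)
  moreover have "closed_subspace W"
    unfolding closed_subspace_def complex_vector.subspace_def W_def
    using mem linB B0
    by (auto intro!: continuous_closed_preimage_constant contB \<open>closed M\<close>)
  moreover have "M = {m + n |m n. m \<in> T ` M \<and> n \<in> W}"
  proof
    show "M \<subseteq> {m + n |m n. m \<in> T ` M \<and> n \<in> W}"
    proof
      fix x assume x: "x \<in> M"
      then have "x - T (B x) \<in> W"
        by (simp add: W_def mem diffB BT)
      moreover have "x = T (B x) + (x - T (B x))"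
        by simp
      ultimately show "x \<in> {m + n |m n. m \<in> T ` M \<and> n \<in> W}"
        using mem(1)[OF x] by blast
    qed
  qed (use mem in \<open>auto simp: W_def\<close>)
  moreover have "T ` M \<inter> W = {0}"
    using BT B0 mem linT by (auto simp: W_def image_iff)
  ultimately show ?thesis
    unfolding topologically_complemented_in_def topological_direct_sum_def
    by (intro exI[of _ W] conjI)
qed

text \<open>Injectivity makes \<open>T m + w \<mapsto> m\<close> well defined on
  \<open>M = T(M) + W\<close>. Automatic continuity bounds it, and at \<open>w = 0\<close> it undoes
  \<open>T\<close>.\<close>

lemma range_complemented_imp_left_invertible:
  fixes T :: "'a::complex_banach \<Rightarrow> 'a"
  assumes T: "T \<in> \<B> UNIV" and M: "closed_subspace M" "T ` M \<subseteq> M"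
    and inj: "\<And>x. x \<in> M \<Longrightarrow> T x = 0 \<Longrightarrow> x = 0"
    and compl: "topologically_complemented_in M (T ` M)"
  shows "left_invertible_on M T"
proof -
  obtain W where "topological_direct_sum M (T ` M) W"
    using compl unfolding topologically_complemented_in_def by blast
  note sum = this[unfolded topological_direct_sum_def]
  have W: "closed_subspace W"
    using sum by (elim conjE)
  have M_eq: "M = {m + n |m n. m \<in> T ` M \<and> n \<in> W}"
    using sum by (elim conjE)
  have int: "T ` M \<inter> W = {0}"
    using sum by (elim conjE)
  have subW: "complex_vector.subspace W"
    using W by (simp add: closed_subspace_def)
  have "\<exists>g\<in>\<B> M. \<forall>m\<in>M. \<forall>w\<in>W. g (T m + w) = m"
  proof (rule direct_sum_component_operator[OF T M(1) W M(1)])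
    show "M = {T m + w |m w. m \<in> M \<and> w \<in> W}"
      by (rule trans[OF M_eq]) blast
    fix m w assume *: "m \<in> M" "w \<in> W" "T m + w = 0"
    then have "T m = - w"
      by (simp add: eq_neg_iff_add_eq_0)
    then have "T m \<in> W"
      using * complex_vector.subspace_neg[OF subW] by simp
    then have "T m = 0"
      using int * by blast
    then show "m = 0"
      using inj * by blast
  qed simp
  then obtain g where "g \<in> \<B> M" and g: "\<And>m w. m \<in> M \<Longrightarrow> w \<in> W \<Longrightarrow> g (T m + w) = m"
    by blast
  moreover have "g (T m) = m" if "m \<in> M" for m
    using g[OF that complex_vector.subspace_0[OF subW]] by simp
  ultimately show ?thesis
    unfolding left_invertible_on_def using bounded_operators_subset[OF T M(2)] by blast
qed

text \<open>For fixed \<open>e\<close> the operators \<open>T ^^ n\<close> divided by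
  \<open>e ^ n\<close> are pointwise bounded on \<open>H\<^sub>0 T\<close>; closedness lets uniform
  boundedness provide a constant independent of the vector.\<close>

lemma closed_quasi_nilpotent_part_imp_quasi_nilpotent:
  fixes T :: "'a::complex_banach \<Rightarrow> 'a"
  assumes T: "T \<in> \<B> UNIV" and closed: "closed (H\<^sub>0 T)"
  shows "quasi_nilpotent_on (H\<^sub>0 T) T"
proof -
  note sub = subspace_quasi_nilpotent_part[OF T]
  have TH: "T \<in> \<B> (H\<^sub>0 T)" "H\<^sub>0 T \<noteq> {}"
    using bounded_operators_subset[OF T quasi_nilpotent_part_image] complex_vector.subspace_0[OF sub]
    by auto
  show ?thesis
    unfolding quasi_nilpotent_on_iff[OF TH]
  proof (intro allI impI)
    fix e :: real assume e: "e > 0"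
    have "\<exists>C. \<forall>n. \<forall>x\<in>H\<^sub>0 T. norm ((1 / e ^ n) *\<^sub>R (T ^^ n) x) \<le> C * norm x"
    proof (rule pointwise_bounded_imp_uniformly_bounded)
      show "subspace (H\<^sub>0 T)"
        by (rule complex_subspace_imp_subspace[OF sub])
      show "bounded_linear (\<lambda>x. (1 / e ^ n) *\<^sub>R (T ^^ n) x)" for n
        using bounded_operators_funpow[OF T, of n]
        by (intro bounded_linear_const_scaleR) (simp add: bounded_operators_UNIV)
      fix x assume "x \<in> H\<^sub>0 T"
      then obtain C where "\<And>n. norm ((T ^^ n) x) \<le> C * e ^ n"
        using e unfolding mem_quasi_nilpotent_part_iff by blast
      then show "\<exists>C. \<forall>n. norm ((1 / e ^ n) *\<^sub>R (T ^^ n) x) \<le> C"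
        using e by (intro exI[of _ C]) (simp add: field_simps)
    qed (rule closed)
    then show "\<exists>C. \<forall>n. \<forall>x\<in>H\<^sub>0 T. norm ((T ^^ n) x) \<le> C * e ^ n * norm x"
      using e by (simp add: field_simps)
  qed
qed

section \<open>Equivalence of the five conditions, with (v) as the hub\<close>

theorem theorem3p6:
  fixes T :: "'a::complex_banach \<Rightarrow> 'a"
  assumes "T \<in> \<B> UNIV"
  shows "let
      i = (\<exists>S\<in>\<B> UNIV. T \<circ> S \<circ> T = S \<circ> (T ^^ 2) \<and> (S ^^ 2) \<circ> T = S \<and>
            quasi_nilpotent_on UNIV (\<lambda>x. (T \<circ> S \<circ> T) x - T x));
      ii = (\<exists>P. projection P \<and> T \<circ> P = P \<circ> T \<and>
            left_invertible_on UNIV (\<lambda>x. T x + P x) \<and>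
            quasi_nilpotent_on UNIV (T \<circ> P));
      iii = (\<exists>M. topological_direct_sum UNIV M (H\<^sub>0 T) \<and>
            T ` M \<subseteq> M \<and> topologically_complemented_in M (T ` M));
      iv = (\<exists>M. reduce M (H\<^sub>0 T) T \<and>
            left_invertible_on M T \<and> quasi_nilpotent_on (H\<^sub>0 T) T);
      v = (\<exists>M N. reduce M N T \<and>
            left_invertible_on M T \<and> quasi_nilpotent_on N T)
    in (i \<longleftrightarrow> ii) \<and> (ii \<longleftrightarrow> iii) \<and> (iii \<longleftrightarrow> iv) \<and> (iv \<longleftrightarrow> v)"
proof -
  note T = assms
  note linT = bounded_operators_UNIV_simps[OF T]
  define i where "i \<longleftrightarrow> (\<exists>S\<in>\<B> UNIV. T \<circ> S \<circ> T = S \<circ> (T ^^ 2) \<and> (S ^^ 2) \<circ> T = S \<and>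
            quasi_nilpotent_on UNIV (\<lambda>x. (T \<circ> S \<circ> T) x - T x))"
  define ii where "ii \<longleftrightarrow> (\<exists>P. projection P \<and> T \<circ> P = P \<circ> T \<and>
            left_invertible_on UNIV (\<lambda>x. T x + P x) \<and>
            quasi_nilpotent_on UNIV (T \<circ> P))"
  define iii where "iii \<longleftrightarrow> (\<exists>M. topological_direct_sum UNIV M (H\<^sub>0 T) \<and>
            T ` M \<subseteq> M \<and> topologically_complemented_in M (T ` M))"
  define iv where "iv \<longleftrightarrow> (\<exists>M. reduce M (H\<^sub>0 T) T \<and>
            left_invertible_on M T \<and> quasi_nilpotent_on (H\<^sub>0 T) T)"
  define v where "v \<longleftrightarrow> (\<exists>M N. reduce M N T \<and>
            left_invertible_on M T \<and> quasi_nilpotent_on N T)"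
  have "i \<Longrightarrow> v"
  proof -
    assume i
    then obtain S where S: "S \<in> \<B> UNIV" and 1: "T \<circ> S \<circ> T = S \<circ> (T ^^ 2)" and 2: "(S ^^ 2) \<circ> T = S"
      and qn: "quasi_nilpotent_on UNIV (\<lambda>x. (T \<circ> S \<circ> T) x - T x)"
      unfolding i_def by blast
    note linS = bounded_operators_UNIV_simps[OF S]
    have TST: "T (S (T x)) = S (T (T x))" and SST: "S (S (T x)) = S x" for x
      using fun_cong[OF 1, of x] fun_cong[OF 2, of x] by (simp_all add: numeral_2_eq_2)
    \<comment> \<open>The two identities for \<open>S\<close> make \<open>S \<circ> T\<close>
      idempotent: \<open>S T S T = S S T T = S T\<close>. The first also makes it commute with
      \<open>T\<close>.\<close>
    define P where "P = (\<lambda>x. x - S (T x))"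
    show v
      unfolding v_def
    proof (rule projection_imp_reduce[OF T _ _ S])
      have "P \<in> \<B> UNIV"
        unfolding P_def
        by (rule bounded_operators_diff[OF complex_vector.subspace_UNIV bounded_operators_id
              bounded_operators_comp[OF S T]])
      then show "projection P"
        by (auto simp: projection_def P_def fun_eq_iff linT linS TST SST)
      show "T \<circ> P = P \<circ> T"
        by (auto simp: P_def fun_eq_iff linT TST)
      show "S (T x) = x" if "P x = 0" for x
        using that by (simp add: P_def)
      have "T \<circ> P = (\<lambda>x. - ((T \<circ> S \<circ> T) x - T x))"
        by (auto simp: P_def fun_eq_iff linT)
      then show "quasi_nilpotent_on UNIV (T \<circ> P)"
        using quasi_nilpotent_on_uminus[OF qn] by simp
    qed
  qed
  moreover have "ii \<Longrightarrow> v"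
  proof -
    assume ii
    then obtain P L where P: "projection P" "T \<circ> P = P \<circ> T" "quasi_nilpotent_on UNIV (T \<circ> P)"
      and "L \<in> \<B> UNIV" and L: "\<And>x. L (T x + P x) = x"
      unfolding ii_def left_invertible_on_def by blast
    \<comment> \<open>On the kernel of \<open>P\<close> the operator \<open>T + P\<close> acts as
      \<open>T\<close>.\<close>
    moreover have "L (T x) = x" if "P x = 0" for x
      using L[of x] that by simp
    ultimately show v
      unfolding v_def by (intro projection_imp_reduce[OF T])
  qed
  moreover have "v \<Longrightarrow> i \<and> ii"
  proof -
    assume v
    then obtain P S where P: "projection P" "T \<circ> P = P \<circ> T" and S: "S \<in> \<B> UNIV"
      and ST: "\<And>x. S (T x) = x - P x" and SP: "\<And>x. S (P x) = 0"
      and qn: "quasi_nilpotent_on UNIV (T \<circ> P)"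
      unfolding v_def using reduce_imp_projection[OF T] by metis
    note linS = bounded_operators_UNIV_simps[OF S]
    have P': "P \<in> \<B> UNIV" and PP: "P (P x) = P x" and TP: "T (P x) = P (T x)" for x
      using P by (auto simp: projection_def fun_eq_iff)
    note linP = bounded_operators_UNIV_simps[OF P']
    have "(\<lambda>x. (T \<circ> S \<circ> T) x - T x) = (\<lambda>x. - (T \<circ> P) x)"
      by (auto simp: ST linT)
    then have "quasi_nilpotent_on UNIV (\<lambda>x. (T \<circ> S \<circ> T) x - T x)"
      using quasi_nilpotent_on_uminus[OF qn] by simp
    \<comment> \<open>Both sides of the first identity equal \<open>T - P T\<close>; the second is
      \<open>S (I - P) = S\<close>, from \<open>S P = 0\<close>.\<close>
    moreover have "T \<circ> S \<circ> T = S \<circ> (T ^^ 2)" "(S ^^ 2) \<circ> T = S"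
      by (auto simp: numeral_2_eq_2 ST linT linS TP SP)
    ultimately have i
      unfolding i_def using S by blast
    moreover have ii
    proof -
      obtain R where R: "R \<in> \<B> UNIV" "\<And>x. R (x + (T \<circ> P) x) = x"
        using Neumann_inverse[OF qn] by blast
      have "(\<lambda>x. S x + R (P x)) \<in> \<B> UNIV" "(\<lambda>x. T x + P x) \<in> \<B> UNIV"
        by (rule bounded_operators_add[OF complex_vector.subspace_UNIV S bounded_operators_comp[OF R(1) P']],
            rule bounded_operators_add[OF complex_vector.subspace_UNIV T P'])
      \<comment> \<open>\<open>S (T + P) = I - P\<close>, while
        \<open>P (T + P) = (I + T P) P\<close>, from which \<open>R\<close> recovers
        \<open>P\<close>.\<close>
      moreover have "S (T x + P x) + R (P (T x + P x)) = x" for x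
        using R(2)[of "P x"] by (simp add: linS linP ST SP PP TP add.commute)
      ultimately have "left_invertible_on UNIV (\<lambda>x. T x + P x)"
        unfolding left_invertible_on_def by (intro conjI bexI[of _ "\<lambda>x. S x + R (P x)"]) simp_all
      then show ii
        unfolding ii_def using P qn by blast
    qed
    ultimately show "i \<and> ii" by blast
  qed
  moreover have "v \<Longrightarrow> iv"
    unfolding v_def iv_def using reduce_imp_quasi_nilpotent_part[OF T] by metis
  moreover have "iv \<Longrightarrow> v"
    unfolding v_def iv_def by blast
  moreover have "iv \<Longrightarrow> iii"
    unfolding iv_def iii_def using left_invertible_imp_range_complemented[OF T]
    by (auto simp: reduce_def topological_direct_sum_def)
  moreover have "iii \<Longrightarrow> iv"
  proof -
    assume iii
    then obtain M where sum: "topological_direct_sum UNIV M (H\<^sub>0 T)"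
      and TM: "T ` M \<subseteq> M" and compl: "topologically_complemented_in M (T ` M)"
      unfolding iii_def by blast
    have M: "closed_subspace M" and H: "closed (H\<^sub>0 T)" and int: "M \<inter> H\<^sub>0 T = {0}"
      using sum unfolding topological_direct_sum_def closed_subspace_def by blast+
    \<comment> \<open>The kernel of \<open>T\<close> lies in \<open>H\<^sub>0 T\<close>, because
      such orbits vanish after their initial term. As \<open>M\<close> meets
      \<open>H\<^sub>0 T\<close> only in 0, \<open>T\<close> is injective on
      \<open>M\<close>.\<close>
    have "x \<in> H\<^sub>0 T" if "T x = 0" for x
      unfolding mem_quasi_nilpotent_part_iff
    proof (intro allI impI)
      fix e :: real assume e: "e > 0"
      have "norm ((T ^^ n) x) \<le> norm x * e ^ n" for n
      proof (cases n)
        case (Suc k)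
        then have "(T ^^ n) x = 0"
          using that bounded_operators_UNIV_simps(4)[OF bounded_operators_funpow[OF T, of k]]
          by (simp add: funpow_swap1)
        then show ?thesis
          using e by simp
      qed simp
      then show "\<exists>C. \<forall>n. norm ((T ^^ n) x) \<le> C * e ^ n"
        by blast
    qed
    then have "left_invertible_on M T"
      using int by (intro range_complemented_imp_left_invertible[OF T M TM _ compl]) blast
    then show iv
      unfolding iv_def reduce_def
      using sum TM closed_quasi_nilpotent_part_imp_quasi_nilpotent[OF T H] quasi_nilpotent_part_image
      by blast
  qed
  ultimately have "(i \<longleftrightarrow> ii) \<and> (ii \<longleftrightarrow> iii) \<and> (iii \<longleftrightarrow> iv) \<and> (iv \<longleftrightarrow> v)"
    by blast
  then show ?thesis
    unfolding Let_def i_def ii_def iii_def iv_def v_def .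
qed

end
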